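(* For any integer $n\ge2$, with $d_2=\gcd(2,n)$, $$[\mathbb{D}_{2n}^d]\circledcirc[\mathrm{SO}(2)\oplus\mathbb{Z}_2^c]=\{[\mathbb{1}],[\mathbb{Z}_2],[\mathbb{Z}_2^-],[\mathbb{Z}_{2n}^-]\},$$ $$[\mathbb{D}_{2n}^d]\circledcirc[\mathrm{O}(2)\oplus\mathbb{Z}_2^c]=\{[\mathbb{1}],[\mathbb{Z}_2],[\mathbb{Z}_2^-],[\mathbb{D}_{d_2}],[\mathbb{D}_2^z],[\mathbb{D}_{2n}^d]\}.$$
   Context: $[K]$ is the conjugacy class of a subgroup $K$ in $\mathrm{O}(3)$, and the clips operation is $[H_1]\circledcirc[H_2]=\{[H_1\cap gH_2g^{-1}]:g\in\mathrm{O}(3)\}$. $(e_1,e_2,e_3)$ is the canonical basis of $\mathbb{R}^3$, $\mathbf{r}(n,\theta)$ is the rotation by angle $\theta$ about the axis directed by $n\neq0$. $\mathbb{1}=\{\mathrm{Id}\}$; $\mathbb{Z}_2^c=\{\pm\mathrm{Id}\}$; $H\oplus\mathbb{Z}_2^c=H\cup(-H)$ for $H\subset\mathrm{SO}(3)$; $\mathbb{Z}_k=\{\mathbf{r}(e_3,2j\pi/k):0\le j\le k-1\}$; $\mathbb{D}_k=\langle\mathbf{r}(e_3,2\pi/k),\mathbf{r}(e_1,\pi)\rangle$ for $k\ge2$; $\mathbb{Z}_{2k}^-=\mathbb{Z}_k\cup(-\mathbf{r}(e_3,\pi/k))\mathbb{Z}_k$ for $k\ge1$ (so $\mathbb{Z}_2^-=\{\mathrm{Id},-\mathbf{r}(e_3,\pi)\}$);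 $\mathbb{D}_2^z=\mathbb{Z}_2\cup(-\mathbf{r}(e_1,\pi))\mathbb{Z}_2$; $\mathbb{D}_{2k}^d=\mathbb{D}_k\cup(-\mathbf{r}(e_3,\pi/k))\mathbb{D}_k$ (the superscript $d$ is part of the name). $\mathrm{SO}(2)=\{\mathbf{r}(e_3,\theta):\theta\in[0,2\pi]\}$ and $\mathrm{O}(2)=\mathrm{SO}(2)\cup\{\mathbf{r}(b,\pi):b\ne0\text{ in the }(xy)\text{-plane}\}$, as subgroups of $\mathrm{SO}(3)$. Convention: $[\mathbb{D}_1]=[\mathbb{Z}_2]$. *)

theory Defs
  imports "HOL-Analysis.Analysis" "HOL-Algebra.Generated_Groups"
begin

type_synonym mat3 = "real^3^3"

definition O3 :: "mat3 monoid" where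
  "O3 = \<lparr>carrier = {A. orthogonal_matrix A}, mult = (**), one = mat 1\<rparr>"

definition conj_by :: "mat3 \<Rightarrow> mat3 set \<Rightarrow> mat3 set" where
  "conj_by g H = (\<lambda>A. g ** A ** matrix_inv g) ` H"

definition conj_class :: "mat3 set \<Rightarrow> mat3 set set" where
  "conj_class K = {conj_by g K | g. g \<in> carrier O3}"

(* The operation is defined on classes, letting the representatives range over both classes;
   clips_conj_class below shows that any fixed pair of representatives suffices. *)
definition clips :: "mat3 set set \<Rightarrow> mat3 set set \<Rightarrow> mat3 set set set" where
  "clips C1 C2 = {conj_class (H1 \<inter> conj_by g H2) | H1 H2 g. H1 \<in> C1 \<and> H2 \<in> C2 \<and> g \<in> carrier O3}"

definition e1 :: "real^3" where "e1 = axis 1 1"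
definition e2 :: "real^3" where "e2 = axis 2 1"
definition e3 :: "real^3" where "e3 = axis 3 1"

(* Rodrigues' formula; only meaningful for n \<noteq> 0. *)
definition rot :: "real^3 \<Rightarrow> real \<Rightarrow> mat3" where
  "rot n \<theta> = (let u = n /\<^sub>R norm n in
     matrix (\<lambda>v. cos \<theta> *\<^sub>R v + sin \<theta> *\<^sub>R cross3 u v + ((1 - cos \<theta>) * (u \<bullet> v)) *\<^sub>R u))"

definition Triv :: "mat3 set" where
  "Triv = {mat 1}"

(* H \<oplus> Z_2^c *)
definition plus_Z2c :: "mat3 set \<Rightarrow> mat3 set" where
  "plus_Z2c H = H \<union> uminus ` H"

(* Cyc k and Dih k are Z_k and D_k. *)
definition Cyc :: "nat \<Rightarrow> mat3 set" where
  "Cyc k = {rot e3 (2 * real j * pi / real k) | j. j < k}"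

(* For k = 1 this is the convention [D_1] = [Z_2]. *)
definition Dih :: "nat \<Rightarrow> mat3 set" where
  "Dih k = (if k = 1 then Cyc 2 else generate O3 {rot e3 (2 * pi / real k), rot e1 pi})"

(* Z_{2k}^- and D_{2k}^d, indexed by k rather than by 2k; in particular Z_2^- is Z2k_minus 1. *)
definition Z2k_minus :: "nat \<Rightarrow> mat3 set" where
  "Z2k_minus k = Cyc k \<union> (\<lambda>A. (- rot e3 (pi / real k)) ** A) ` Cyc k"

definition D2k_d :: "nat \<Rightarrow> mat3 set" where
  "D2k_d k = Dih k \<union> (\<lambda>A. (- rot e3 (pi / real k)) ** A) ` Dih k"

definition D2_z :: "mat3 set" where
  "D2_z = Cyc 2 \<union> (\<lambda>A. (- rot e1 pi) ** A) ` Cyc 2"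

definition SO2 :: "mat3 set" where
  "SO2 = {rot e3 \<theta> | \<theta>. \<theta> \<in> {0..2 * pi}}"

definition O2 :: "mat3 set" where
  "O2 = SO2 \<union> {rot b pi | b. b \<noteq> 0 \<and> b \<in> span {e1, e2}}"

lemma matrix_inv_orthogonal:
  fixes g :: mat3
  assumes "orthogonal_matrix g"
  shows "matrix_inv g = transpose g"
proof -
  have "transpose g ** g = mat 1" "g ** transpose g = mat 1"
    using assms by (auto simp: orthogonal_matrix_def)
  moreover from this have "g ** matrix_inv g = mat 1"
    unfolding matrix_inv_def by (metis (mono_tags, lifting) someI_ex)
  ultimately show ?thesis
    by (metis matrix_mul_assoc matrix_mul_lid matrix_mul_rid)
qed

lemma group_O3: "group O3"
proof (rule groupI)
  fix x assume "x \<in> carrier O3"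
  then show "\<exists>y\<in>carrier O3. y \<otimes>\<^bsub>O3\<^esub> x = \<one>\<^bsub>O3\<^esub>"
    by (intro bexI[of _ "transpose x"]) (auto simp: O3_def orthogonal_matrix_def)
qed (auto simp: O3_def orthogonal_matrix_mul orthogonal_matrix_id matrix_mul_assoc)

lemma rot_e3:
  "rot e3 \<theta> = vector [vector [cos \<theta>, - sin \<theta>, 0], vector [sin \<theta>, cos \<theta>, 0], vector [0, 0, 1]]"
  by (simp add: rot_def e3_def Let_def matrix_def vec_eq_iff forall_3 cross3_def inner_vec_def
      sum_3 axis_def norm_vec_def L2_set_def)

lemma rot_orthogonal:
  assumes "n \<noteq> 0"
  shows "rot n \<theta> \<in> carrier O3"
proof -
  define u where "u = n /\<^sub>R norm n"
  define f where "f = (\<lambda>v. cos \<theta> *\<^sub>R v + sin \<theta> *\<^sub>R cross3 u v + ((1 - cos \<theta>) * (u \<bullet> v)) *\<^sub>R u)"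
  have u: "u \<bullet> u = 1" using assms by (simp add: u_def dot_square_norm)
  have lin: "linear f"
    unfolding f_def
    by (rule linearI) (simp_all add: cross3_def vec_eq_iff forall_3 inner_vec_def sum_3 algebra_simps)
  have "f v \<bullet> f w = v \<bullet> w" for v w
  proof -
    have c: "cross3 u v \<bullet> u = 0" "u \<bullet> cross3 u v = 0" "cross3 u w \<bullet> u = 0" "u \<bullet> cross3 u w = 0"
      "cross3 u v \<bullet> w = - (v \<bullet> cross3 u w)"
      by (simp_all add: cross3_def inner_vec_def sum_3 algebra_simps)
    have d: "cross3 u v \<bullet> cross3 u w = v \<bullet> w - (u \<bullet> v) * (u \<bullet> w)"
      using u dot_cross[of u v u w] by (simp add: inner_commute)
    have uv: "v \<bullet> u = u \<bullet> v" by (rule inner_commute)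
    have "f v \<bullet> f w = (cos \<theta>)\<^sup>2 * (v \<bullet> w) + (sin \<theta>)\<^sup>2 * (v \<bullet> w - (u \<bullet> v) * (u \<bullet> w))
        + 2 * cos \<theta> * (1 - cos \<theta>) * (u \<bullet> v) * (u \<bullet> w) + (1 - cos \<theta>)\<^sup>2 * (u \<bullet> v) * (u \<bullet> w)"
      unfolding f_def inner_add_left inner_add_right inner_scaleR_left inner_scaleR_right c d u uv
      by algebra
    also have "\<dots> = v \<bullet> w"
      unfolding sin_squared_eq by (simp add: power2_eq_square algebra_simps)
    finally show ?thesis .
  qed
  with lin have "orthogonal_transformation f"
    by (simp add: orthogonal_transformation_def)
  then show ?thesis
    by (simp add: orthogonal_transformation_matrix O3_def rot_def Let_def f_def u_def)
qed

lemma conj_by_conj_by: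
  assumes "g \<in> carrier O3" "h \<in> carrier O3"
  shows "conj_by g (conj_by h H) = conj_by (g ** h) H"
  using assms
  by (auto simp: conj_by_def O3_def image_image matrix_inv_orthogonal orthogonal_matrix_mul
      matrix_transpose_mul matrix_mul_assoc)

lemma conj_by_one: "conj_by (mat 1) H = H"
  by (simp add: conj_by_def matrix_inv_orthogonal orthogonal_matrix_id transpose_mat)

lemma conj_by_Int:
  assumes "g \<in> carrier O3"
  shows "conj_by g (H \<inter> K) = conj_by g H \<inter> conj_by g K"
proof -
  have g: "transpose g ** g = mat 1" "g ** transpose g = mat 1"
    using assms by (auto simp: O3_def orthogonal_matrix_def)
  have "inj (\<lambda>A. g ** A ** transpose g)"
  proof (rule injI)
    fix A B assume "g ** A ** transpose g = g ** B ** transpose g"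
    then have "transpose g ** (g ** A ** transpose g) ** g = transpose g ** (g ** B ** transpose g) ** g"
      by simp
    moreover have "transpose g ** (g ** X ** transpose g) ** g = X" for X
      by (metis g(1) matrix_mul_assoc matrix_mul_lid matrix_mul_rid)
    ultimately show "A = B" by simp
  qed
  then show ?thesis
    using assms by (simp add: conj_by_def O3_def matrix_inv_orthogonal image_Int)
qed

lemma conj_class_conj_by:
  assumes "g \<in> carrier O3"
  shows "conj_class (conj_by g K) = conj_class K"
proof -
  have t: "transpose g \<in> carrier O3" and g: "g ** transpose g = mat 1"
    using assms by (auto simp: O3_def orthogonal_matrix_def)
  have m: "x ** y \<in> carrier O3" if "x \<in> carrier O3" "y \<in> carrier O3" for x y
    using that by (simp add: O3_def orthogonal_matrix_mul)
  have "conj_by h (conj_by g K) \<in> conj_class K" if "h \<in> carrier O3" for h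
    using that assms m by (auto simp: conj_class_def conj_by_conj_by)
  moreover have "conj_by h K \<in> conj_class (conj_by g K)" if h: "h \<in> carrier O3" for h
  proof -
    have "transpose g ** g = mat 1" using assms by (auto simp: O3_def orthogonal_matrix_def)
    then have "conj_by h K = conj_by (h ** transpose g) (conj_by g K)"
      using h t assms m by (simp add: conj_by_conj_by flip: matrix_mul_assoc)
    then show ?thesis using h t m by (auto simp: conj_class_def)
  qed
  ultimately show ?thesis by (auto simp: conj_class_def)
qed

lemma clips_conj_class:
  "clips (conj_class H1) (conj_class H2) = {conj_class (H1 \<inter> conj_by g H2) | g. g \<in> carrier O3}"
    (is "?L = ?R")
proof
  have m: "x ** y \<in> carrier O3" if "x \<in> carrier O3" "y \<in> carrier O3" for x y
    using that by (simp add: O3_def orthogonal_matrix_mul)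
  show "?L \<subseteq> ?R"
  proof
    fix C assume "C \<in> ?L"
    then obtain a b g where abg: "a \<in> carrier O3" "b \<in> carrier O3" "g \<in> carrier O3"
      and C: "C = conj_class (conj_by a H1 \<inter> conj_by g (conj_by b H2))"
      by (auto simp: clips_def conj_class_def[of H1] conj_class_def[of H2])
    define h where "h = transpose a ** (g ** b)"
    have t: "transpose a \<in> carrier O3" "a ** transpose a = mat 1"
      using abg by (auto simp: O3_def orthogonal_matrix_def)
    then have h: "h \<in> carrier O3" using abg m by (simp add: h_def)
    have "a ** h = g ** b" using t by (simp add: h_def matrix_mul_assoc)
    then have "conj_by a H1 \<inter> conj_by g (conj_by b H2) = conj_by a (H1 \<inter> conj_by h H2)"
      using abg h by (simp add: conj_by_Int conj_by_conj_by)
    then show "C \<in> ?R" using C abg h by (auto simp: conj_class_conj_by)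
  qed
  have "H \<in> conj_class H" for H
    using conj_by_one[of H] by (force simp: conj_class_def O3_def orthogonal_matrix_id)
  then show "?R \<subseteq> ?L" by (auto simp: clips_def)
qed

end

theory Submission
  imports Defs
begin

text \<open>
  Both infinite groups are stabilisers of the axis \<open>e3\<close>. The group \<open>SO(2) \<oplus> Z_2^c\<close> consists of
  the \<open>A\<close> in \<open>O(3)\<close> with \<open>A e3 = det(A) e3\<close>, and \<open>O(2) \<oplus> Z_2^c\<close> of those with \<open>A e3 = \<plusminus>e3\<close>.
  Conjugation by \<open>g\<close> replaces \<open>e3\<close> by \<open>g e3\<close>, so each clips set consists of the classes of
  \<open>D \<inter> S v\<close>, where \<open>D\<close> is the group \<open>D_{2n}^d\<close>, \<open>S v\<close> is the stabiliser in question
  and \<open>v\<close> ranges over all axes (lemma \<open>clips_by_axis\<close>).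

  Write \<open>\<real>^3 = \<complex> \<times> \<real>\<close>. Every element of \<open>D\<close> is, up to sign, a rotation
  \<open>(w, z) \<mapsto> (c w, z)\<close> or a half-turn \<open>(w, z) \<mapsto> (c \<cdot> cnj w, -z)\<close> with \<open>|c| = 1\<close>. In these terms
  \<open>D = D_{2n}^d\<close> has the uniform description \<open>c^n = s\<close> with \<open>s = \<plusminus>1\<close> the sign of the element
  (lemma \<open>D2k_d_roots\<close>), which replaces all bookkeeping of angles by algebra with roots of \<open>1\<close>
  and \<open>-1\<close>.

  For \<open>v = (w, z)\<close> with \<open>w \<noteq> 0\<close>, a half-turn fixes \<open>v\<close> iff \<open>z = 0\<close> and \<open>c = w / cnj w\<close>, and sends it
  to \<open>-v\<close> iff \<open>c = -w / cnj w\<close>; a rotation other than the identity can preserve the line of \<open>v\<close>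
  only if \<open>z = 0\<close> and \<open>c = -1\<close>. Hence the intersection is determined by the position of \<open>v\<close>:
  the vertical axis gives \<open>Z_{2n}^-\<close> in the first problem and all of \<open>D\<close> in the second. Any other axis
  leaves the identity and at most one signed half-turn, except a horizontal axis in the second
  problem, which leaves the identity, \<open>(-1)^n\<close> times the vertical half-turn, and either none or two
  signed horizontal half-turns. The value of \<open>c^n\<close> (\<open>1\<close>,
  \<open>-1\<close> or neither) and the parity of \<open>n\<close> then decide the conjugacy class. As \<open>w / cnj w\<close> takes
  every value on the unit circle, all of these cases occur.
\<close>

section \<open>Rotations and half-turns in cylindrical coordinates\<close>

definition axrot :: "complex \<Rightarrow> mat3" where
  "axrot c = vector [vector [Re c, - Im c, 0], vector [Im c, Re c, 0], vector [0, 0, 1]]"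

text \<open>The half-turn about the horizontal axis through a square root of \<open>c\<close> (for \<open>|c| = 1\<close>).\<close>
definition halfturn :: "complex \<Rightarrow> mat3" where
  "halfturn c = vector [vector [Re c, Im c, 0], vector [Im c, - Re c, 0], vector [0, 0, - 1]]"

definition cyl :: "complex \<Rightarrow> real \<Rightarrow> real^3" where
  "cyl w z = vector [Re w, Im w, z]"

lemmas mat3_simps = vec_eq_iff forall_3 matrix_matrix_mult_def matrix_vector_mult_def sum_3
  mat_def transpose_def axrot_def halfturn_def cyl_def

lemma cyl_exhaust: obtains w z where "v = cyl w z"
  by (rule that[of "Complex (v$1) (v$2)" "v$3"]) (simp add: mat3_simps)

lemma cyl_eq_iff [simp]: "cyl w z = cyl w' z' \<longleftrightarrow> w = w' \<and> z = z'"
  by (auto simp: mat3_simps complex_eq_iff)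

lemma uminus_cyl [simp]: "- cyl w z = cyl (- w) (- z)"
  by (simp add: mat3_simps)

lemma e3_cyl: "e3 = cyl 0 1"
  by (simp add: mat3_simps e3_def axis_def)

lemma cyl_add: "cyl w z + cyl w' z' = cyl (w + w') (z + z')"
  by (simp add: mat3_simps)

lemma cyl_scaleR: "t *\<^sub>R cyl w z = cyl (t *\<^sub>R w) (t * z)"
  by (simp add: mat3_simps)

lemma e2_cyl: "e2 = cyl \<i> 0"
  by (simp add: mat3_simps e2_def axis_def)

lemma e1_cyl: "e1 = cyl 1 0"
  by (simp add: mat3_simps e1_def axis_def)

lemma cyl_eq_0_iff [simp]: "cyl w z = 0 \<longleftrightarrow> w = 0 \<and> z = 0"
  by (auto simp: mat3_simps complex_eq_iff)

lemma axrot_cyl [simp]: "axrot c *v cyl w z = cyl (c * w) z"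
  by (simp add: mat3_simps)

lemma halfturn_cyl [simp]: "halfturn c *v cyl w z = cyl (c * cnj w) (- z)"
  by (simp add: mat3_simps)

lemma uminus_mat3_vector [simp]: "(- A) *v v = - (A *v v)" for A :: mat3
  by (simp add: mat3_simps)

lemma mat3_vector_uminus [simp]: "A *v (- v) = - (A *v v)" for A :: mat3
  by (simp add: mat3_simps)

lemma uminus_mat3_mult [simp]: "(- A) ** B = - (A ** B)" for A :: mat3
  by (simp add: mat3_simps)

lemma mat3_mult_uminus [simp]: "A ** (- B) = - (A ** B)" for A :: mat3
  by (simp add: mat3_simps)

lemma axrot_1: "axrot 1 = mat 1"
  by (simp add: mat3_simps)

lemma axrot_mult: "axrot c ** axrot d = axrot (c * d)"
  and axrot_halfturn: "axrot c ** halfturn d = halfturn (c * d)"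
  and halfturn_axrot: "halfturn c ** axrot d = halfturn (c * cnj d)"
  and halfturn_mult: "halfturn c ** halfturn d = axrot (c * cnj d)"
  by (simp_all add: mat3_simps)

lemma transpose_axrot: "transpose (axrot c) = axrot (cnj c)"
  and transpose_halfturn: "transpose (halfturn c) = halfturn c"
  by (simp_all add: mat3_simps)

lemma axrot_eq_iff [simp]: "axrot c = axrot d \<longleftrightarrow> c = d"
  by (auto simp: mat3_simps complex_eq_iff)

lemma cnj_mult_self: "norm c = 1 \<Longrightarrow> c * cnj c = 1" "norm c = 1 \<Longrightarrow> cnj c * c = 1"
  by (simp_all add: complex_norm_square[symmetric] mult.commute[of "cnj c"])

lemma norm_sqr_parts: "norm c = 1 \<Longrightarrow> Re c * Re c + Im c * Im c = 1"
  by (metis cmod_power2 one_power2 power2_eq_square)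

lemma axrot_O3: "norm c = 1 \<Longrightarrow> axrot c \<in> carrier O3"
  and halfturn_O3: "norm c = 1 \<Longrightarrow> halfturn c \<in> carrier O3"
  by (simp_all add: O3_def orthogonal_matrix_def transpose_axrot transpose_halfturn axrot_mult
      halfturn_mult cnj_mult_self axrot_1)

lemma uminus_O3 [simp]: "- A \<in> carrier O3 \<longleftrightarrow> A \<in> carrier O3"
proof -
  have "transpose (- A) = - transpose A"
    by (simp add: mat3_simps)
  then show ?thesis
    by (simp add: O3_def orthogonal_matrix_def)
qed

lemma det_axrot: "norm c = 1 \<Longrightarrow> det (axrot c) = 1"
  and det_halfturn: "norm c = 1 \<Longrightarrow> det (halfturn c) = 1"
  by (simp_all add: det_3 axrot_def halfturn_def norm_sqr_parts)

lemma det_uminus_3: "det (- A) = - det (A :: mat3)"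
  by (simp add: det_3)

lemma rot_e3_axrot: "rot e3 t = axrot (cis t)"
  by (simp add: rot_e3 axrot_def)

text \<open>
  For \<open>|w| = 1\<close> one has \<open>w / cnj w = w * w\<close>, so a square root of \<open>c\<close> does both jobs: the direction
  \<open>w\<close> is the axis of the half-turn \<open>c\<close>, and rotating by \<open>w\<close> moves the half-turn \<open>1\<close> to the
  half-turn \<open>c\<close>.
\<close>
lemma unit_eq_divide_cnj:
  assumes "norm c = 1"
  obtains w where "norm w = 1" "w * w = c" "w / cnj w = c" "w \<noteq> 0"
proof -
  define w where "w = csqrt c"
  have w: "norm w = 1" "w * w = c"
    using assms by (simp_all add: w_def flip: power2_eq_square)
  moreover have "w / cnj w = c"
    using w cnj_mult_self[of w] by (auto simp: divide_eq_eq mult.assoc)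
  ultimately show ?thesis
    using that by force
qed

lemma unit_iff_divide_cnj: "norm c = 1 \<longleftrightarrow> (\<exists>w. w \<noteq> 0 \<and> c = w / cnj w)"
  using unit_eq_divide_cnj[of c] by (auto simp: norm_divide)

lemma rot_pi_halfturn:
  assumes "w \<noteq> 0"
  shows "rot (cyl w 0) pi = halfturn (w / cnj w)"
proof -
  define a where "a = sgn w"
  have a: "norm a = 1"
    using assms by (simp add: a_def norm_sgn)
  have w: "w = of_real (norm w) * a"
    using assms by (simp add: a_def sgn_div_norm scaleR_conv_of_real)
  have "norm (cyl w 0) = norm w"
    by (simp add: norm_vec_def L2_set_def sum_3 cyl_def cmod_def)
  then have u: "cyl w 0 /\<^sub>R norm (cyl w 0) = cyl a 0"
    by (simp add: mat3_simps a_def sgn_div_norm)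
  have "w / cnj w = (of_real (norm w) * a) / cnj (of_real (norm w) * a)"
    using w by metis
  also have "\<dots> = a * a"
    using assms a by (simp add: divide_eq_eq mult.assoc cnj_mult_self)
  finally have "w / cnj w = a * a" .
  moreover have "Im a * Im a = 1 - Re a * Re a"
    using norm_sqr_parts[OF a] by simp
  ultimately show ?thesis
    unfolding rot_def Let_def u
    by (simp add: mat3_simps matrix_def axis_def inner_vec_def cross3_def algebra_simps)
qed

text \<open>
  Orthogonality turns \<open>A e3 = \<plusminus>e3\<close> into block form, with an orthogonal \<open>2 \<times> 2\<close> block. The four
  sign combinations of the block's determinant and of the corner entry are the four cases.
\<close>
lemma mat3_fixing_axis_cases:
  assumes A: "A \<in> carrier O3" and ax: "A *v e3 = e3 \<or> A *v e3 = - e3"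
  obtains c where "norm c = 1" "A \<in> {axrot c, - axrot c, halfturn c, - halfturn c}"
proof -
  obtain s :: real where s: "s = 1 \<or> s = -1" and "A *v e3 = s *\<^sub>R e3"
    using ax by (metis scaleR_minus_left scaleR_one)
  then have col3: "A$1$3 = 0" "A$2$3 = 0" "A$3$3 = s"
    by (simp_all add: mat3_simps e3_def axis_def)
  have T: "transpose A ** A = mat 1" and T': "A ** transpose A = mat 1"
    using A by (simp_all add: O3_def orthogonal_matrix_def)
  have "(A ** transpose A)$3$3 = 1"
    using T' by (simp add: mat_def)
  then have "(A$3$1)\<^sup>2 + (A$3$2)\<^sup>2 = 0"
    using s by (auto simp: mat3_simps col3 power2_eq_square)
  then have row3: "A$3$1 = 0" "A$3$2 = 0"
    by (simp_all add: sum_power2_eq_zero_iff)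
  have ortho: "(A$1$1)\<^sup>2 + (A$2$1)\<^sup>2 = 1" "(A$1$2)\<^sup>2 + (A$2$2)\<^sup>2 = 1"
      "A$1$1 * A$1$2 + A$2$1 * A$2$2 = 0"
    using T by (simp_all add: mat3_simps row3 power2_eq_square)
  define e where "e = A$1$1 * A$2$2 - A$1$2 * A$2$1"
  have "e\<^sup>2 = 1"
    using ortho unfolding e_def by algebra
  then have e: "e = 1 \<or> e = -1"
    by (simp add: power2_eq_1_iff)
  have col2: "A$1$2 = - e * A$2$1" "A$2$2 = e * A$1$1"
    using ortho unfolding e_def by algebra+
  define c where "c = Complex (A$1$1) (A$2$1)"
  have c: "norm c = 1"
    using ortho by (simp add: c_def cmod_def)
  from s e have "A = axrot c \<or> A = - axrot (- c) \<or> A = halfturn c \<or> A = - halfturn (- c)"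
    by (auto simp: mat3_simps c_def col2 col3 row3)
  then show ?thesis
    using that[of c] that[of "- c"] c by auto
qed

section \<open>The two groups as stabilisers of an axis\<close>

text \<open>
  Proper elements fix \<open>v\<close> and improper ones reverse it. Using the determinant makes the condition
  invariant under \<open>A \<mapsto> -A\<close> and under conjugation.
\<close>

definition axial :: "real^3 \<Rightarrow> mat3 set" where
  "axial v = {A \<in> carrier O3. A *v v = det A *\<^sub>R v}"

definition line_stab :: "real^3 \<Rightarrow> mat3 set" where
  "line_stab v = {A \<in> carrier O3. A *v v = v \<or> A *v v = - v}"

lemma SO2_eq: "SO2 = {axrot c | c. norm c = 1}"
proof -
  have "\<exists>t\<in>{0..2 * pi}. c = cis t" if "norm c = 1" for c
    using that Arg2pi[of c]
    by (intro bexI[of _ "Arg2pi c"]) (auto simp: cis_conv_exp is_Arg_def)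
  then show ?thesis
    unfolding SO2_def rot_e3_axrot by force
qed

lemma O2_eq: "O2 = {axrot c | c. norm c = 1} \<union> {halfturn c | c. norm c = 1}"
proof -
  have "span {e1, e2} = {cyl w 0 | w. True}"
  proof -
    have "subspace {cyl w 0 | w. True}"
    proof (rule subspaceI)
      show "0 \<in> {cyl w 0 | w. True}"
        by (rule CollectI, rule exI[of _ 0]) (simp add: mat3_simps)
    qed (auto simp: cyl_add cyl_scaleR)
    then have "span {e1, e2} \<subseteq> {cyl w 0 | w. True}"
      by (intro span_minimal) (auto simp: e1_cyl e2_cyl)
    moreover have "cyl w 0 = Re w *\<^sub>R e1 + Im w *\<^sub>R e2" for w
      by (simp add: mat3_simps e1_def e2_def axis_def)
    then have "cyl w 0 \<in> span {e1, e2}" for w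
      by (simp add: span_add span_scale span_base)
    ultimately show ?thesis
      by blast
  qed
  then have "A \<in> {rot b pi | b. b \<noteq> 0 \<and> b \<in> span {e1, e2}} \<longleftrightarrow>
      (\<exists>w. w \<noteq> 0 \<and> A = rot (cyl w 0) pi)" for A
    by auto
  also have "(\<exists>w. w \<noteq> 0 \<and> A = rot (cyl w 0) pi) \<longleftrightarrow> (\<exists>w. w \<noteq> 0 \<and> A = halfturn (w / cnj w))" for A
    by (simp add: rot_pi_halfturn cong: conj_cong)
  also have "(\<exists>w. w \<noteq> 0 \<and> A = halfturn (w / cnj w)) \<longleftrightarrow> A \<in> {halfturn c | c. norm c = 1}" for A
    unfolding unit_iff_divide_cnj by auto
  finally have "{rot b pi | b. b \<noteq> 0 \<and> b \<in> span {e1, e2}} = {halfturn c | c. norm c = 1}"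
    unfolding set_eq_iff by (rule allI)
  then show ?thesis
    unfolding O2_def SO2_eq by (rule arg_cong)
qed

text \<open>The determinant excludes the two half-turn cases, which reverse \<open>e3\<close> with determinant \<open>1\<close>
  or fix it with determinant \<open>-1\<close>.\<close>
lemma plus_Z2c_SO2: "plus_Z2c SO2 = axial e3"
proof
  show "plus_Z2c SO2 \<subseteq> axial e3"
    by (auto simp: plus_Z2c_def SO2_eq axial_def axrot_O3 det_uminus_3 det_axrot e3_cyl)
  show "axial e3 \<subseteq> plus_Z2c SO2"
  proof
    fix A assume "A \<in> axial e3"
    then have A: "A \<in> carrier O3" and ax: "A *v e3 = det A *\<^sub>R e3"
      by (auto simp: axial_def)
    then have "A *v e3 = e3 \<or> A *v e3 = - e3"
      using det_orthogonal_matrix[of A] by (auto simp: O3_def)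
    then obtain c where c: "norm c = 1" "A \<in> {axrot c, - axrot c, halfturn c, - halfturn c}"
      using A mat3_fixing_axis_cases by blast
    moreover have "A \<noteq> halfturn c" "A \<noteq> - halfturn c"
      using ax c(1) by (auto simp: det_uminus_3 det_halfturn e3_cyl)
    ultimately show "A \<in> plus_Z2c SO2"
      by (auto simp: plus_Z2c_def SO2_eq)
  qed
qed

lemma plus_Z2c_O2: "plus_Z2c O2 = line_stab e3"
proof
  show "plus_Z2c O2 \<subseteq> line_stab e3"
    by (auto simp: plus_Z2c_def O2_eq line_stab_def axrot_O3 halfturn_O3 e3_cyl)
  show "line_stab e3 \<subseteq> plus_Z2c O2"
  proof
    fix A assume "A \<in> line_stab e3"
    then obtain c where "norm c = 1" "A \<in> {axrot c, - axrot c, halfturn c, - halfturn c}"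
      unfolding line_stab_def using mat3_fixing_axis_cases by blast
    then show "A \<in> plus_Z2c O2"
      by (auto simp: plus_Z2c_def O2_eq)
  qed
qed

text \<open>
  \<open>O(3)\<close> acts transitively on unit vectors, so the conjugates of the stabiliser of \<open>e3\<close> are exactly
  the stabilisers of the nonzero vectors. Admitting nonzero rather than unit vectors keeps later
  choices of \<open>v\<close> free of square roots.
\<close>
lemma clips_by_axis:
  assumes conj: "\<And>g. g \<in> carrier O3 \<Longrightarrow> conj_by g (S e3) = S (g *v e3)"
    and scale: "\<And>t v. t \<noteq> 0 \<Longrightarrow> S (t *\<^sub>R v) = S v"
  shows "clips (conj_class H) (conj_class (S e3)) = {conj_class (H \<inter> S v) | v. v \<noteq> 0}"
proof -
  have "\<exists>v. v \<noteq> 0 \<and> conj_by g (S e3) = S v" if g: "g \<in> carrier O3" for g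
  proof -
    have "transpose g *v (g *v e3) = e3"
      using g by (simp add: O3_def orthogonal_matrix_def matrix_vector_mul_assoc)
    then have "g *v e3 \<noteq> 0"
      by (auto simp: e3_cyl)
    with conj[OF g] show ?thesis by blast
  qed
  moreover have "\<exists>g\<in>carrier O3. conj_by g (S e3) = S v" if v: "v \<noteq> 0" for v
  proof -
    have "norm e3 = norm (v /\<^sub>R norm v)"
      using v by (simp add: e3_def)
    then obtain f where f: "orthogonal_transformation f" "f e3 = v /\<^sub>R norm v"
      using orthogonal_transformation_exists by blast
    then have "matrix f \<in> carrier O3" "matrix f *v e3 = v /\<^sub>R norm v"
      by (auto simp: O3_def orthogonal_transformation_matrix matrix_works)
    then show ?thesis
      using conj scale[of "inverse (norm v)" v] v by (intro bexI[of _ "matrix f"]) auto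
  qed
  ultimately show ?thesis
    unfolding clips_conj_class by (safe; metis)
qed

lemma conj_by_Collect_O3:
  assumes g: "g \<in> carrier O3"
  shows "conj_by g {A \<in> carrier O3. P A} = {A \<in> carrier O3. P (transpose g ** A ** g)}"
proof -
  have T: "transpose g ** g = mat 1" "g ** transpose g = mat 1" "matrix_inv g = transpose g"
    using g by (auto simp: O3_def orthogonal_matrix_def matrix_inv_orthogonal)
  then have [simp]: "transpose g ** (g ** A ** transpose g) ** g = A"
      "g ** (transpose g ** A ** g) ** transpose g = A" for A
    by (metis matrix_mul_assoc matrix_mul_lid matrix_mul_rid)+
  have "g ** A ** transpose g \<in> carrier O3" "transpose g ** A ** g \<in> carrier O3"
    if "A \<in> carrier O3" for A
    using that g by (simp_all add: O3_def orthogonal_matrix_mul)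
  then show ?thesis
    unfolding conj_by_def T(3)
    by (force simp: image_iff)
qed

lemma conj_vector_eq_iff:
  assumes g: "g \<in> carrier O3"
  shows "(transpose g ** A ** g) *v u = v \<longleftrightarrow> A *v (g *v u) = g *v v"
proof -
  have T: "transpose g ** g = mat 1" "g ** transpose g = mat 1"
    using g by (auto simp: O3_def orthogonal_matrix_def)
  show ?thesis
    by (metis T matrix_mul_assoc matrix_vector_mul_assoc matrix_vector_mul_lid)
qed

lemma clips_axial: "clips (conj_class H) (conj_class (axial e3)) = {conj_class (H \<inter> axial v) | v. v \<noteq> 0}"
proof (rule clips_by_axis)
  fix g assume g: "g \<in> carrier O3"
  have "det g * det g = 1"
    using g det_orthogonal_matrix[of g] by (auto simp: O3_def)
  then have "det (transpose g ** A ** g) = det A" for A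
    by (simp add: det_mul)
  then show "conj_by g (axial e3) = axial (g *v e3)"
    unfolding axial_def conj_by_Collect_O3[OF g]
    by (simp add: matrix_vector_mult_scaleR conj_vector_eq_iff[OF g])
next
  fix t :: real and v :: "real^3" assume "t \<noteq> 0"
  then have "t *\<^sub>R x = d *\<^sub>R (t *\<^sub>R v) \<longleftrightarrow> x = d *\<^sub>R v" for x d
    using scaleR_left_commute[of d t v] scaleR_cancel_left[of t x "d *\<^sub>R v"] by auto
  then show "axial (t *\<^sub>R v) = axial v"
    by (simp only: axial_def matrix_vector_mult_scaleR)
qed

lemma clips_line_stab: "clips (conj_class H) (conj_class (line_stab e3)) = {conj_class (H \<inter> line_stab v) | v. v \<noteq> 0}"
proof (rule clips_by_axis)
  fix g assume g: "g \<in> carrier O3"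
  show "conj_by g (line_stab e3) = line_stab (g *v e3)"
    unfolding line_stab_def conj_by_Collect_O3[OF g]
    by (simp add: conj_vector_eq_iff[OF g])
next
  fix t :: real and v :: "real^3" assume "t \<noteq> 0"
  then show "line_stab (t *\<^sub>R v) = line_stab v"
    by (simp add: line_stab_def matrix_vector_mult_scaleR flip: scaleR_minus_right)
qed

section \<open>The finite groups in terms of roots of unity\<close>

lemma Cyc_roots:
  assumes "n \<ge> 1"
  shows "Cyc n = {axrot c | c. c ^ n = 1}"
proof -
  have "{c. c ^ n = 1} = (\<lambda>j. cis (2 * pi * real j / real n)) ` {..<n}"
    using assms Complex.bij_betw_roots_unity[of n] by (simp add: bij_betw_def)
  moreover have "Cyc n = axrot ` (\<lambda>j. cis (2 * pi * real j / real n)) ` {..<n}"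
    by (auto simp: Cyc_def rot_e3_axrot image_image mult_ac)
  ultimately show ?thesis
    by (simp add: setcompr_eq_image)
qed

lemma roots_of_minus_1:
  assumes "w ^ n = (-1 :: complex)" "n \<ge> 1"
  shows "(\<lambda>c. w * c) ` {c. c ^ n = 1} = {c. c ^ n = -1}"
proof -
  have "w \<noteq> 0"
    using assms by (auto simp: power_0_left)
  then have "c \<in> (\<lambda>c. w * c) ` {c. c ^ n = 1}" if "c ^ n = -1" for c
    using assms that by (intro image_eqI[of _ _ "c / w"]) (auto simp: power_divide)
  then show ?thesis
    using assms by (auto simp: power_mult_distrib)
qed

lemma cis_pi_div_power: "n \<ge> 1 \<Longrightarrow> cis (pi / real n) ^ n = -1"
  by (simp add: Complex.DeMoivre)

lemma Z2k_minus_roots: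
  assumes n: "n \<ge> 1"
  shows "Z2k_minus n = (\<Union>s\<in>{1, -1}. (\<lambda>c. s *\<^sub>R axrot c) ` {c. c ^ n = of_real s})"
proof -
  let ?w = "cis (pi / real n)"
  have "Z2k_minus n = axrot ` {c. c ^ n = 1} \<union> (\<lambda>c. - axrot c) ` (\<lambda>c. ?w * c) ` {c. c ^ n = 1}"
    by (simp add: Z2k_minus_def Cyc_roots[OF n] rot_e3_axrot axrot_mult setcompr_eq_image image_image)
  then show ?thesis
    unfolding roots_of_minus_1[OF cis_pi_div_power[OF n] n] by simp
qed

lemma root_of_unity_norm:
  fixes c :: complex
  assumes "n \<ge> 1" "c ^ n = of_real s" "s \<in> {1, -1}"
  shows "norm c = 1"
proof -
  have "norm c ^ n = 1"
    using assms by (auto simp flip: norm_power)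
  then show ?thesis
    using assms(1) power_eq_imp_eq_base[of "norm c" n 1] by simp
qed

lemma inv_O3:
  assumes "A \<in> carrier O3"
  shows "inv\<^bsub>O3\<^esub> A = transpose A"
proof (rule group.inv_equality[OF group_O3])
  show "transpose A \<otimes>\<^bsub>O3\<^esub> A = \<one>\<^bsub>O3\<^esub>" "transpose A \<in> carrier O3"
    using assms by (auto simp: O3_def orthogonal_matrix_def)
qed (fact assms)

text \<open>
  The condition \<open>c^n = 1\<close> is preserved by products and conjugates, so the right-hand side is a group
  containing the generators. Conversely each root of unity is a power of the primitive one, and
  half-turns are rotations times the half-turn \<open>1\<close>.
\<close>
lemma Dih_roots:
  assumes n: "n \<ge> 2"
  shows "Dih n = {axrot c | c. c ^ n = 1} \<union> {halfturn c | c. c ^ n = 1}" (is "_ = ?S")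
proof -
  define z where "z = cis (2 * pi / real n)"
  have norm: "norm c = 1" if "c ^ n = 1" for c :: complex
    using root_of_unity_norm[of n c 1] that n by simp
  have zn: "z ^ n = 1"
    using n by (simp add: z_def Complex.DeMoivre)
  have gens: "Dih n = generate O3 {axrot z, halfturn 1}"
    using n rot_pi_halfturn[of 1]
    by (simp add: Dih_def rot_e3_axrot z_def e1_cyl)
  have "A \<in> ?S" if "A \<in> generate O3 {axrot z, halfturn 1}" for A
    using that
  proof induction
    case one
    have "axrot 1 \<in> ?S" by auto
    then show ?case by (simp add: axrot_1 O3_def)
  next
    case (incl h)
    then show ?case using zn by auto
  next
    case (inv h)
    have "cnj z ^ n = 1"
      using zn by (metis complex_cnj_one complex_cnj_power)
    then show ?case
      using inv norm[OF zn]
      by (auto simp: inv_O3 axrot_O3 halfturn_O3 transpose_axrot transpose_halfturn)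
  next
    case (eng A B)
    have "(c * d) ^ n = 1" "(c * cnj d) ^ n = 1" if "c ^ n = 1" "d ^ n = 1" for c d :: complex
      using that by (simp_all add: power_mult_distrib flip: complex_cnj_power)
    with eng.IH show ?case
      by (auto simp: O3_def axrot_mult axrot_halfturn halfturn_axrot halfturn_mult)
  qed
  moreover have "axrot c \<in> Dih n \<and> halfturn c \<in> Dih n" if c: "c ^ n = 1" for c
  proof -
    have pow: "axrot (z ^ j) \<in> Dih n" for j
    proof (induction j)
      case 0
      show ?case
        using generate.one[of O3] by (simp add: gens axrot_1 O3_def)
    next
      case (Suc j)
      then show ?case
        using generate.eng[of "axrot z" O3 _ "axrot (z ^ j)"] generate.incl[of "axrot z" _ O3]
        by (simp add: gens O3_def axrot_mult)
    qed
    have "axrot c \<in> Cyc n"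
      using c n by (auto simp: Cyc_roots)
    then obtain j where "axrot c = axrot (cis (2 * real j * pi / real n))"
      by (auto simp: Cyc_def rot_e3_axrot)
    then have "c = z ^ j"
      by (simp add: z_def Complex.DeMoivre mult_ac)
    then have c: "axrot c \<in> Dih n"
      using pow by simp
    moreover have "axrot c ** halfturn 1 \<in> Dih n"
      using generate.eng[of "axrot c" O3 _ "halfturn 1"] generate.incl[of "halfturn 1" _ O3] c
      by (simp add: gens O3_def)
    ultimately show ?thesis
      by (simp add: axrot_halfturn)
  qed
  ultimately show ?thesis
    using gens by blast
qed

text \<open>Multiplication by \<open>-axrot(cis(\<pi>/n))\<close> flips the sign of the element together with the sign of
  \<open>c^n\<close>, which keeps the two tied.\<close>
lemma D2k_d_roots:
  assumes n: "n \<ge> 2"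
  shows "D2k_d n = (\<Union>s\<in>{1, -1}. (\<lambda>c. s *\<^sub>R axrot c) ` {c. c ^ n = of_real s} \<union>
    (\<lambda>c. s *\<^sub>R halfturn c) ` {c. c ^ n = of_real s})"
proof -
  let ?w = "cis (pi / real n)"
  have w: "?w ^ n = -1"
    using n cis_pi_div_power[of n] by simp
  have "D2k_d n = axrot ` {c. c ^ n = 1} \<union> halfturn ` {c. c ^ n = 1} \<union>
      (\<lambda>c. - axrot c) ` (\<lambda>c. ?w * c) ` {c. c ^ n = 1} \<union>
      (\<lambda>c. - halfturn c) ` (\<lambda>c. ?w * c) ` {c. c ^ n = 1}"
    unfolding D2k_d_def Dih_roots[OF n] rot_e3_axrot
    by (simp add: setcompr_eq_image image_Un image_image axrot_mult axrot_halfturn Un_ac)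
  also have "(\<lambda>c. ?w * c) ` {c. c ^ n = 1} = {c. c ^ n = -1}"
    using roots_of_minus_1[OF w] n by simp
  finally show ?thesis
    by (simp add: Un_ac)
qed

lemma Cyc_2_list: "Cyc 2 = {mat 1, axrot (-1)}"
  by (auto simp: Cyc_roots power2_eq_1_iff axrot_1[symmetric])

lemma Dih_2_list: "Dih 2 = {mat 1, axrot (-1), halfturn 1, halfturn (-1)}"
  by (auto simp: Dih_roots power2_eq_1_iff axrot_1[symmetric])

lemma Z2_minus_list: "Z2k_minus 1 = {mat 1, - axrot (-1)}"
  by (auto simp: Z2k_minus_roots axrot_1[symmetric])

lemma D2_z_list: "D2_z = {mat 1, axrot (-1), - halfturn 1, - halfturn (-1)}"
proof -
  have "rot e1 pi = halfturn 1"
    using rot_pi_halfturn[of 1] by (simp add: e1_cyl)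
  then show ?thesis
    by (auto simp: D2_z_def Cyc_2_list halfturn_axrot)
qed

section \<open>Recognising conjugacy classes\<close>

text \<open>A reflection interchanging the first and third axes; it exchanges the vertical half-turn with
  the half-turn about \<open>e1\<close>.\<close>

definition swap13 :: mat3 where
  "swap13 = vector [vector [0, 0, 1], vector [0, 1, 0], vector [1, 0, 0]]"

lemma conj_by_image:
  assumes "g \<in> carrier O3"
  shows "conj_by g H = (\<lambda>A. g ** A ** transpose g) ` H"
  using assms by (simp add: conj_by_def O3_def matrix_inv_orthogonal)

lemma conj_by_axrot:
  assumes "w * w = c" "norm w = 1"
  shows "axrot w ** transpose (axrot w) = mat 1"
    and "axrot w ** axrot d ** transpose (axrot w) = axrot d"
    and "axrot w ** halfturn d ** transpose (axrot w) = halfturn (c * d)"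
  using assms cnj_mult_self[of w]
  by (simp_all add: transpose_axrot axrot_mult axrot_halfturn halfturn_axrot axrot_1 mult_ac)

lemma conj_by_swap13:
  "swap13 ** axrot (-1) ** transpose swap13 = halfturn 1"
  "swap13 ** halfturn 1 ** transpose swap13 = axrot (-1)"
  "swap13 ** halfturn (-1) ** transpose swap13 = halfturn (-1)"
  "swap13 ** transpose swap13 = mat 1"
  "swap13 \<in> carrier O3"
  by (simp_all add: swap13_def O3_def orthogonal_matrix_def mat3_simps)

lemma conj_class_axrot:
  assumes "norm w = 1"
  shows "conj_class ((\<lambda>A. axrot w ** A ** transpose (axrot w)) ` H) = conj_class H"
  using assms conj_class_conj_by[of "axrot w" H] by (simp add: conj_by_image axrot_O3)

lemma conj_class_swap13:
  "conj_class ((\<lambda>A. swap13 ** A ** transpose swap13) ` H) = conj_class H"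
  using conj_class_conj_by[of swap13 H] by (simp add: conj_by_image conj_by_swap13)

lemma conj_class_swap13_list:
  "conj_class {mat 1, halfturn 1} = conj_class (Cyc 2)"
  "conj_class {mat 1, - halfturn 1} = conj_class (Z2k_minus 1)"
  "conj_class {mat 1, - axrot (-1), halfturn 1, - halfturn (-1)} = conj_class D2_z"
  using conj_class_swap13[of "Cyc 2"] conj_class_swap13[of "Z2k_minus 1"] conj_class_swap13[of "D2_z"]
  by (simp_all add: Cyc_2_list Z2_minus_list[simplified] D2_z_list conj_by_swap13 insert_commute)

text \<open>
  Rotating by a square root of \<open>c\<close> reduces every case to \<open>c = 1\<close>; where the vertical axis of the
  standard group has to become horizontal, exchanging the axes \<open>e1\<close> and \<open>e3\<close> finishes the job. The
  last case is an instance of the latter: there the only proper half-turn is horizontal, whereas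
  in \<open>D2_z\<close> it is vertical.
\<close>
lemma conj_class_halfturn:
  assumes c: "norm c = 1"
  shows "conj_class {mat 1, halfturn c} = conj_class (Cyc 2)"
    and "conj_class {mat 1, - halfturn c} = conj_class (Z2k_minus 1)"
    and "conj_class {mat 1, axrot (-1), halfturn c, halfturn (- c)} = conj_class (Dih 2)"
    and "conj_class {mat 1, axrot (-1), - halfturn c, - halfturn (- c)} = conj_class D2_z"
    and "conj_class {mat 1, - axrot (-1), halfturn c, - halfturn (- c)} = conj_class D2_z"
proof -
  obtain w where w: "norm w = 1" "w * w = c"
    using unit_eq_divide_cnj[OF c] by blast
  note eq = conj_class_axrot[OF w(1)]
  note [simp] = conj_by_axrot[OF w(2,1)]
  show "conj_class {mat 1, halfturn c} = conj_class (Cyc 2)"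
    using eq[of "{mat 1, halfturn 1}"] by (simp add: conj_class_swap13_list)
  show "conj_class {mat 1, - halfturn c} = conj_class (Z2k_minus 1)"
    using eq[of "{mat 1, - halfturn 1}"] by (simp add: conj_class_swap13_list)
  show "conj_class {mat 1, axrot (-1), halfturn c, halfturn (- c)} = conj_class (Dih 2)"
    using eq[of "Dih 2"] by (simp add: Dih_2_list)
  show "conj_class {mat 1, axrot (-1), - halfturn c, - halfturn (- c)} = conj_class D2_z"
    using eq[of "D2_z"] by (simp add: D2_z_list)
  show "conj_class {mat 1, - axrot (-1), halfturn c, - halfturn (- c)} = conj_class D2_z"
    using eq[of "{mat 1, - axrot (-1), halfturn 1, - halfturn (-1)}"]
    by (simp add: conj_class_swap13_list)
qed

section \<open>Intersections with the stabiliser of an axis\<close>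

lemma signed_singleton:
  fixes h :: "'a :: real_vector" and z :: complex
  shows "{s *\<^sub>R h | s. s \<in> {1, -1} \<and> z = of_real s} =
    (if z = 1 then {h} else if z = -1 then {- h} else {})"
proof -
  have "s \<in> {1, -1} \<and> z = of_real s \<longleftrightarrow> s = 1 \<and> z = 1 \<or> s = -1 \<and> z = -1" for s
    by auto
  then have "{s *\<^sub>R h | s. s \<in> {1, -1} \<and> z = of_real s} =
      {s *\<^sub>R h | s. s = 1 \<and> z = 1} \<union> {s *\<^sub>R h | s. s = -1 \<and> z = -1}"
    by blast
  also have "\<dots> = (if z = 1 then {h} else if z = -1 then {- h} else {})"
    by simp
  finally show ?thesis .
qed

text \<open>
  The elements \<open>\<plusminus>halfturn c\<close> of \<open>D2k_d n\<close>: there is at most one, because \<open>c^n\<close> prescribes the sign.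
\<close>
definition signed_halfturn :: "nat \<Rightarrow> complex \<Rightarrow> mat3 set" where
  "signed_halfturn n c = {s *\<^sub>R halfturn c | s. s \<in> {1, -1} \<and> c ^ n = of_real s}"

lemma signed_halfturn_simps:
  "c ^ n = 1 \<Longrightarrow> signed_halfturn n c = {halfturn c}"
  "c ^ n = -1 \<Longrightarrow> signed_halfturn n c = {- halfturn c}"
  "c ^ n \<noteq> 1 \<Longrightarrow> c ^ n \<noteq> -1 \<Longrightarrow> signed_halfturn n c = {}"
  unfolding signed_halfturn_def signed_singleton by simp_all

lemma uminus_axial: "- A \<in> axial v \<longleftrightarrow> A \<in> axial v"
  unfolding axial_def mem_Collect_eq uminus_O3 uminus_mat3_vector det_uminus_3
    scaleR_minus_left neg_equal_iff_equal ..

lemma uminus_line_stab: "- A \<in> line_stab v \<longleftrightarrow> A \<in> line_stab v"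
proof -
  have "- x = v \<longleftrightarrow> x = - v" for x
    using neg_equal_iff_equal[of x "- v"] by simp
  then show ?thesis
    unfolding line_stab_def mem_Collect_eq uminus_O3 uminus_mat3_vector neg_equal_iff_equal by blast
qed

lemma mem_axial:
  assumes "norm c = 1" "s \<in> {1, -1}"
  shows "s *\<^sub>R axrot c \<in> axial (cyl w z) \<longleftrightarrow> c * w = w"
    and "s *\<^sub>R halfturn c \<in> axial (cyl w z) \<longleftrightarrow> c * cnj w = w \<and> z = 0"
proof -
  have "axrot c \<in> axial (cyl w z) \<longleftrightarrow> c * w = w"
    using assms(1) by (simp add: axial_def axrot_O3 det_axrot)
  then show "s *\<^sub>R axrot c \<in> axial (cyl w z) \<longleftrightarrow> c * w = w"
    using assms(2) by (elim insertE emptyE) (simp_all only: uminus_axial scaleR_one scaleR_minus_left)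
  have "halfturn c \<in> axial (cyl w z) \<longleftrightarrow> c * cnj w = w \<and> z = 0"
    using assms(1) by (simp add: axial_def halfturn_O3 det_halfturn)
  then show "s *\<^sub>R halfturn c \<in> axial (cyl w z) \<longleftrightarrow> c * cnj w = w \<and> z = 0"
    using assms(2) by (elim insertE emptyE) (simp_all only: uminus_axial scaleR_one scaleR_minus_left)
qed

lemma mem_line_stab:
  assumes "norm c = 1" "s \<in> {1, -1}"
  shows "s *\<^sub>R axrot c \<in> line_stab (cyl w z) \<longleftrightarrow> c * w = w \<or> c * w = - w \<and> z = 0"
    and "s *\<^sub>R halfturn c \<in> line_stab (cyl w z) \<longleftrightarrow> c * cnj w = w \<and> z = 0 \<or> c * cnj w = - w"
proof -
  have "axrot c \<in> line_stab (cyl w z) \<longleftrightarrow> c * w = w \<or> c * w = - w \<and> z = 0"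
    using assms(1) by (simp add: line_stab_def axrot_O3)
  then show "s *\<^sub>R axrot c \<in> line_stab (cyl w z) \<longleftrightarrow> c * w = w \<or> c * w = - w \<and> z = 0"
    using assms(2) by (elim insertE emptyE) (simp_all only: uminus_line_stab scaleR_one scaleR_minus_left)
  have "halfturn c \<in> line_stab (cyl w z) \<longleftrightarrow> c * cnj w = w \<and> z = 0 \<or> c * cnj w = - w"
    using assms(1) by (simp add: line_stab_def halfturn_O3)
  then show "s *\<^sub>R halfturn c \<in> line_stab (cyl w z) \<longleftrightarrow> c * cnj w = w \<and> z = 0 \<or> c * cnj w = - w"
    using assms(2) by (elim insertE emptyE) (simp_all only: uminus_line_stab scaleR_one scaleR_minus_left)
qed

lemma UN_image_Collect: "(\<Union>s\<in>T. f s ` {c. R s c}) = {f s c | s c. s \<in> T \<and> R s c}"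
  by blast

text \<open>
  With abstract families and an abstract sign set this is pure logic; for the sign set \<open>{1, -1}\<close> it
  intersects \<open>D2k_d n\<close> with \<open>S\<close>.
\<close>
lemma UN_images_Int:
  assumes "\<And>s c. R s c \<Longrightarrow> s \<in> T \<Longrightarrow> f s c \<in> S \<longleftrightarrow> P c"
    and "\<And>s c. R s c \<Longrightarrow> s \<in> T \<Longrightarrow> g s c \<in> S \<longleftrightarrow> Q c"
  shows "(\<Union>s\<in>T. f s ` {c. R s c} \<union> g s ` {c. R s c}) \<inter> S =
    {f s c | s c. s \<in> T \<and> R s c \<and> P c} \<union> (\<Union>c \<in> {c. Q c}. {g s c | s. s \<in> T \<and> R s c})"
  using assms by blast

lemma D2k_d_Int:
  assumes n: "n \<ge> 2"
    and P: "\<And>(s::real) c. norm c = 1 \<Longrightarrow> s \<in> {1, -1} \<Longrightarrow> s *\<^sub>R axrot c \<in> S \<longleftrightarrow> P c"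
    and Q: "\<And>(s::real) c. norm c = 1 \<Longrightarrow> s \<in> {1, -1} \<Longrightarrow> s *\<^sub>R halfturn c \<in> S \<longleftrightarrow> Q c"
  shows "D2k_d n \<inter> S = {s *\<^sub>R axrot c | s c. s \<in> {1, -1} \<and> c ^ n = complex_of_real s \<and> P c} \<union>
    (\<Union>c \<in> {c. Q c}. signed_halfturn n c)"
proof -
  define T :: "real set" where "T = {1, -1}"
  have norm: "norm c = 1" if "c ^ n = complex_of_real s" "s \<in> T" for s c
    using root_of_unity_norm[of n c s] that n by (simp add: T_def)
  have "s *\<^sub>R axrot c \<in> S \<longleftrightarrow> P c" "s *\<^sub>R halfturn c \<in> S \<longleftrightarrow> Q c"
    if "c ^ n = complex_of_real s" "s \<in> T" for s c
    using P Q norm that by (simp_all add: T_def)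
  then show ?thesis
    unfolding D2k_d_roots[OF n] signed_halfturn_def T_def[symmetric] by (rule UN_images_Int)
qed

lemma signed_axrot_singleton:
  assumes "d ^ n = complex_of_real t" "t \<in> {1, -1}"
  shows "{s *\<^sub>R axrot c | s c. s \<in> {1, -1} \<and> c ^ n = complex_of_real s \<and> c = d} = {t *\<^sub>R axrot d}"
proof -
  have "{s *\<^sub>R axrot c | s c. s \<in> {1, -1} \<and> c ^ n = complex_of_real s \<and> c = d} =
      {s *\<^sub>R axrot d | s. s \<in> {1, -1} \<and> d ^ n = complex_of_real s}"
    by blast
  then show ?thesis
    unfolding signed_singleton using assms by auto
qed

lemma mult_eq_sign_iff:
  fixes c w :: complex
  assumes "w \<noteq> 0"
  shows "c * w = w \<longleftrightarrow> c = 1" "c * w = - w \<longleftrightarrow> c = -1"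
proof -
  show "c * w = w \<longleftrightarrow> c = 1"
    using assms by simp
  show "c * w = - w \<longleftrightarrow> c = -1"
    using assms mult_cancel_right[of c w "-1"] by simp
qed

lemma mult_cnj_eq_iff:
  assumes "w \<noteq> 0"
  shows "c * cnj w = w \<longleftrightarrow> c = w / cnj w" "c * cnj w = - w \<longleftrightarrow> c = - (w / cnj w)"
  using assms by (auto simp: field_simps)

text \<open>For \<open>w \<noteq> 0\<close> only the identity rotation fixes \<open>(w, z)\<close>, and half-turns negate \<open>z\<close>; so everything
  hinges on the single half-turn with \<open>c = w / cnj w\<close> when \<open>z = 0\<close>.\<close>
lemma D2k_d_Int_axial:
  assumes n: "n \<ge> 2"
  shows "z \<noteq> 0 \<Longrightarrow> D2k_d n \<inter> axial (cyl 0 z) = Z2k_minus n"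
    and "w \<noteq> 0 \<Longrightarrow> D2k_d n \<inter> axial (cyl w 0) = insert (mat 1) (signed_halfturn n (w / cnj w))"
    and "w \<noteq> 0 \<Longrightarrow> z \<noteq> 0 \<Longrightarrow> D2k_d n \<inter> axial (cyl w z) = {mat 1}"
proof -
  have Int: "D2k_d n \<inter> axial (cyl w z) =
      {s *\<^sub>R axrot c | s c. s \<in> {1, -1} \<and> c ^ n = complex_of_real s \<and> c * w = w} \<union>
      (\<Union>c \<in> {c. c * cnj w = w \<and> z = 0}. signed_halfturn n c)" for w z
    by (rule D2k_d_Int[OF n]) (rule mem_axial; assumption)+
  show "D2k_d n \<inter> axial (cyl 0 z) = Z2k_minus n" if "z \<noteq> 0"
  proof -
    have "n \<ge> 1" using n by simp
    show ?thesis
      unfolding Int Z2k_minus_roots[OF \<open>n \<ge> 1\<close>] UN_image_Collect using that by simp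
  qed
  assume w: "w \<noteq> 0"
  have one: "{s *\<^sub>R axrot c | s c. s \<in> {1, -1} \<and> c ^ n = complex_of_real s \<and> c * w = w} = {mat 1}"
    unfolding mult_eq_sign_iff[OF w] using signed_axrot_singleton[of 1 n 1] by (simp add: axrot_1)
  show "D2k_d n \<inter> axial (cyl w 0) = insert (mat 1) (signed_halfturn n (w / cnj w))"
    unfolding Int one using w by (simp add: mult_cnj_eq_iff)
  show "D2k_d n \<inter> axial (cyl w z) = {mat 1}" if "z \<noteq> 0"
    unfolding Int one using that by simp
qed

text \<open>
  Reversal of \<open>v\<close> is now admitted too. The half-turn with \<open>c = - w / cnj w\<close>, whose axis is horizontal
  and perpendicular to \<open>w\<close>, reverses \<open>(w, z)\<close> for every \<open>z\<close>. If \<open>z = 0\<close>, the rotation by \<open>\<pi>\<close> does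
  so as well, and its sign in \<open>D2k_d n\<close> is \<open>(-1)^n\<close>.
\<close>
lemma D2k_d_Int_line_stab:
  assumes n: "n \<ge> 2"
  shows "D2k_d n \<inter> line_stab (cyl 0 z) = D2k_d n"
    and "w \<noteq> 0 \<Longrightarrow> z \<noteq> 0 \<Longrightarrow>
      D2k_d n \<inter> line_stab (cyl w z) = insert (mat 1) (signed_halfturn n (- (w / cnj w)))"
    and "w \<noteq> 0 \<Longrightarrow> D2k_d n \<inter> line_stab (cyl w 0) = {mat 1, (-1) ^ n *\<^sub>R axrot (-1)} \<union>
      signed_halfturn n (w / cnj w) \<union> signed_halfturn n (- (w / cnj w))"
proof -
  have Int: "D2k_d n \<inter> line_stab (cyl w z) =
      {s *\<^sub>R axrot c | s c. s \<in> {1, -1} \<and> c ^ n = complex_of_real s \<and>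
        (c * w = w \<or> c * w = - w \<and> z = 0)} \<union>
      (\<Union>c \<in> {c. c * cnj w = w \<and> z = 0 \<or> c * cnj w = - w}. signed_halfturn n c)" for w z
    by (rule D2k_d_Int[OF n]) (rule mem_line_stab; assumption)+
  have all: "D2k_d n \<inter> UNIV =
      {s *\<^sub>R axrot c | s c. s \<in> {1, -1} \<and> c ^ n = complex_of_real s \<and> True} \<union>
      (\<Union>c \<in> {c. True}. signed_halfturn n c)"
    by (rule D2k_d_Int[OF n]) simp_all
  have "D2k_d n \<inter> line_stab (cyl 0 z) = D2k_d n \<inter> UNIV"
    unfolding Int all by simp
  then show "D2k_d n \<inter> line_stab (cyl 0 z) = D2k_d n"
    by simp
  assume w: "w \<noteq> 0"
  note eqs = mult_eq_sign_iff[OF w] mult_cnj_eq_iff[OF w]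
  have one: "{s *\<^sub>R axrot c | s c. s \<in> {1, -1} \<and> c ^ n = complex_of_real s \<and> c = 1} = {mat 1}"
    using signed_axrot_singleton[of 1 n 1] by (simp add: axrot_1)
  show "D2k_d n \<inter> line_stab (cyl w z) = insert (mat 1) (signed_halfturn n (- (w / cnj w)))"
    if "z \<noteq> 0"
    unfolding Int eqs using that one by simp
  have "{s *\<^sub>R axrot c | s c. s \<in> {1, -1} \<and> c ^ n = complex_of_real s \<and> (c = 1 \<or> c = -1)} =
      {mat 1, (-1) ^ n *\<^sub>R axrot (-1)}"
  proof -
    have "(-1) ^ n = complex_of_real ((-1) ^ n)" "(-1 :: real) ^ n \<in> {1, -1}"
      by (cases "even n"; simp)+
    from signed_axrot_singleton[OF this] one show ?thesis
      by blast
  qed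
  moreover have "{c. c = w / cnj w \<or> c = - (w / cnj w)} = {w / cnj w, - (w / cnj w)}"
    by auto
  ultimately show "D2k_d n \<inter> line_stab (cyl w 0) = {mat 1, (-1) ^ n *\<^sub>R axrot (-1)} \<union>
      signed_halfturn n (w / cnj w) \<union> signed_halfturn n (- (w / cnj w))"
    unfolding Int eqs by simp
qed

section \<open>The classes that occur\<close>

lemma unit_powers:
  assumes "n \<ge> 1"
  shows "\<exists>c::complex. norm c = 1 \<and> c ^ n = 1"
    and "\<exists>c::complex. norm c = 1 \<and> c ^ n = -1"
    and "\<exists>c::complex. norm c = 1 \<and> c ^ n \<noteq> 1 \<and> c ^ n \<noteq> -1"
proof -
  show "\<exists>c::complex. norm c = 1 \<and> c ^ n = 1"
    by (rule exI[of _ 1]) simp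
  show "\<exists>c::complex. norm c = 1 \<and> c ^ n = -1"
    using cis_pi_div_power[OF assms] by (intro exI[of _ "cis (pi / real n)"]) simp
  \<comment> \<open>Half the angle of a primitive root of \<open>-1\<close>, so that the power lands on \<open>\<i>\<close>.\<close>
  have "cis (pi / (2 * real n)) ^ n = \<i>"
    using assms by (simp add: Complex.DeMoivre)
  then show "\<exists>c::complex. norm c = 1 \<and> c ^ n \<noteq> 1 \<and> c ^ n \<noteq> -1"
    by (intro exI[of _ "cis (pi / (2 * real n))"]) (simp add: complex_eq_iff)
qed

lemma classes_one_halfturn:
  assumes n: "n \<ge> 1"
  shows "{conj_class (insert (mat 1) (signed_halfturn n c)) | c. norm c = 1} =
    {conj_class Triv, conj_class (Cyc 2), conj_class (Z2k_minus 1)}" (is "?L = ?R")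
proof
  show "?L \<subseteq> ?R"
  proof
    fix C assume "C \<in> ?L"
    then obtain c where c: "norm c = 1" "C = conj_class (insert (mat 1) (signed_halfturn n c))"
      by auto
    consider "c ^ n = 1" | "c ^ n = -1" | "c ^ n \<noteq> 1" "c ^ n \<noteq> -1"
      by blast
    then show "C \<in> ?R"
      by cases (simp_all add: c signed_halfturn_simps conj_class_halfturn Triv_def)
  qed
  obtain a :: complex where a: "norm a = 1" "a ^ n = 1"
    using unit_powers(1)[OF n] by blast
  obtain b :: complex where b: "norm b = 1" "b ^ n = -1"
    using unit_powers(2)[OF n] by blast
  obtain c :: complex where c: "norm c = 1" "c ^ n \<noteq> 1" "c ^ n \<noteq> -1"
    using unit_powers(3)[OF n] by blast
  define L where "L = ?L"
  have "conj_class (insert (mat 1) (signed_halfturn n u)) \<in> L" if "norm u = 1" for u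
    unfolding L_def by (rule CollectI, intro exI conjI, rule refl) (fact that)
  from this[of a] this[of b] this[of c] a b c have "?R \<subseteq> L"
    by (simp add: signed_halfturn_simps conj_class_halfturn Triv_def)
  then show "?R \<subseteq> ?L"
    by (simp only: L_def)
qed

text \<open>The intersection of \<open>D2k_d n\<close> with the stabiliser of a horizontal line in direction \<open>w\<close>, where
  \<open>c = w / cnj w\<close>; the half-turns \<open>c\<close> and \<open>-c\<close> are those about \<open>w\<close> and about its horizontal
  perpendicular.\<close>
definition horizontal_stab :: "nat \<Rightarrow> complex \<Rightarrow> mat3 set" where
  "horizontal_stab n c =
    {mat 1, (-1) ^ n *\<^sub>R axrot (-1)} \<union> signed_halfturn n c \<union> signed_halfturn n (- c)"

text \<open>For even \<open>n\<close> the two half-turns carry the same sign, because \<open>(-c)^n = c^n\<close>.\<close>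
lemma conj_class_horizontal_stab_even:
  assumes "even n" "norm c = 1"
  shows "c ^ n = 1 \<Longrightarrow> conj_class (horizontal_stab n c) = conj_class (Dih 2)"
    and "c ^ n = -1 \<Longrightarrow> conj_class (horizontal_stab n c) = conj_class D2_z"
    and "c ^ n \<noteq> 1 \<Longrightarrow> c ^ n \<noteq> -1 \<Longrightarrow> conj_class (horizontal_stab n c) = conj_class (Cyc 2)"
  using assms conj_class_halfturn[of c]
  by (simp_all add: horizontal_stab_def signed_halfturn_simps Cyc_2_list insert_commute)

text \<open>
  For odd \<open>n\<close> they carry opposite signs. The cases \<open>c^n = 1\<close> and \<open>c^n = -1\<close> then differ only by
  exchanging \<open>c\<close> and \<open>-c\<close>, so both give \<open>D2_z\<close>. This parity dichotomy is the source of \<open>gcd 2 n\<close>.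
\<close>
lemma conj_class_horizontal_stab_odd:
  assumes "odd n" "norm c = 1"
  shows "c ^ n = 1 \<Longrightarrow> conj_class (horizontal_stab n c) = conj_class D2_z"
    and "c ^ n = -1 \<Longrightarrow> conj_class (horizontal_stab n c) = conj_class D2_z"
    and "c ^ n \<noteq> 1 \<Longrightarrow> c ^ n \<noteq> -1 \<Longrightarrow> conj_class (horizontal_stab n c) = conj_class (Z2k_minus 1)"
proof -
  have *: "(- c) ^ n = - (c ^ n)"
    using assms by (simp add: power_minus_odd)
  show "c ^ n = 1 \<Longrightarrow> conj_class (horizontal_stab n c) = conj_class D2_z"
    using assms * conj_class_halfturn[of c]
    by (simp add: horizontal_stab_def signed_halfturn_simps insert_commute)
  show "c ^ n = -1 \<Longrightarrow> conj_class (horizontal_stab n c) = conj_class D2_z"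
    using assms * conj_class_halfturn[of "- c"]
    by (simp add: horizontal_stab_def signed_halfturn_simps insert_commute)
  show "c ^ n \<noteq> 1 \<Longrightarrow> c ^ n \<noteq> -1 \<Longrightarrow> conj_class (horizontal_stab n c) = conj_class (Z2k_minus 1)"
  proof -
    assume "c ^ n \<noteq> 1" "c ^ n \<noteq> -1"
    moreover from this have "(- c) ^ n \<noteq> 1" "(- c) ^ n \<noteq> -1"
      unfolding * by (metis minus_minus)+
    ultimately show ?thesis
      using assms(1) by (simp add: horizontal_stab_def signed_halfturn_simps Z2_minus_list del: One_nat_def)
  qed
qed

lemma classes_horizontal_stab:
  assumes n: "n \<ge> 1"
  shows "{conj_class (horizontal_stab n c) | c. norm c = 1} =
    (if even n then {conj_class (Cyc 2), conj_class (Dih 2), conj_class D2_z}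
     else {conj_class (Z2k_minus 1), conj_class D2_z})" (is "?L = ?R")
proof
  note classes = conj_class_horizontal_stab_even conj_class_horizontal_stab_odd
  show "?L \<subseteq> ?R"
  proof
    fix C assume "C \<in> ?L"
    then obtain c where c: "norm c = 1" "C = conj_class (horizontal_stab n c)"
      by auto
    consider "c ^ n = 1" | "c ^ n = -1" | "c ^ n \<noteq> 1" "c ^ n \<noteq> -1"
      by blast
    then show "C \<in> ?R"
      by cases (simp_all add: c classes)
  qed
  obtain a :: complex where a: "norm a = 1" "a ^ n = 1"
    using unit_powers(1)[OF n] by blast
  obtain b :: complex where b: "norm b = 1" "b ^ n = -1"
    using unit_powers(2)[OF n] by blast
  obtain c :: complex where c: "norm c = 1" "c ^ n \<noteq> 1" "c ^ n \<noteq> -1"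
    using unit_powers(3)[OF n] by blast
  define L where "L = ?L"
  have "conj_class (horizontal_stab n u) \<in> L" if "norm u = 1" for u
    unfolding L_def by (rule CollectI, intro exI conjI, rule refl) (fact that)
  from this[of a] this[of b] this[of c] a b c have "?R \<subseteq> L"
    by (cases "even n") (simp_all add: classes del: One_nat_def)
  then show "?R \<subseteq> ?L"
    by (simp only: L_def)
qed

text \<open>The trivial group is listed separately because it arises from every oblique axis.\<close>
lemma axial_classes:
  assumes n: "n \<ge> 2"
  shows "{conj_class (D2k_d n \<inter> axial v) | v. v \<noteq> 0} =
    {conj_class (Z2k_minus n), conj_class Triv} \<union>
    {conj_class (insert (mat 1) (signed_halfturn n c)) | c. norm c = 1}" (is "?L = ?R")
proof
  show "?L \<subseteq> ?R"
  proof
    fix C assume "C \<in> ?L"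
    then obtain v where v: "v \<noteq> 0" "C = conj_class (D2k_d n \<inter> axial v)"
      by blast
    obtain w z where wz: "v = cyl w z"
      by (rule cyl_exhaust)
    consider "w = 0" "z \<noteq> 0" | "w \<noteq> 0" "z = 0" | "w \<noteq> 0" "z \<noteq> 0"
      using v wz by auto
    then show "C \<in> ?R"
      using v unfolding wz unit_iff_divide_cnj
      by cases (auto simp: D2k_d_Int_axial[OF n] Triv_def)
  qed
  show "?R \<subseteq> ?L"
  proof -
    have "conj_class (Z2k_minus n) = conj_class (D2k_d n \<inter> axial (cyl 0 1))"
      "conj_class Triv = conj_class (D2k_d n \<inter> axial (cyl 1 1))"
      by (simp_all add: D2k_d_Int_axial[OF n] Triv_def)
    moreover have "conj_class (insert (mat 1) (signed_halfturn n (w / cnj w))) =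
      conj_class (D2k_d n \<inter> axial (cyl w 0))" if "w \<noteq> 0" for w
      using that by (simp add: D2k_d_Int_axial[OF n])
    moreover have "cyl 0 1 \<noteq> 0" "cyl 1 1 \<noteq> 0" "w \<noteq> 0 \<Longrightarrow> cyl w 0 \<noteq> 0" for w
      by simp_all
    ultimately show ?thesis
      unfolding unit_iff_divide_cnj by blast
  qed
qed

text \<open>The three families come from the vertical, the oblique and the horizontal axes.\<close>
lemma line_stab_classes:
  assumes n: "n \<ge> 2"
  shows "{conj_class (D2k_d n \<inter> line_stab v) | v. v \<noteq> 0} =
    {conj_class (D2k_d n)} \<union>
    {conj_class (insert (mat 1) (signed_halfturn n c)) | c. norm c = 1} \<union>
    {conj_class (horizontal_stab n c) | c. norm c = 1}" (is "?L = ?R")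
proof
  show "?L \<subseteq> ?R"
  proof
    fix C assume "C \<in> ?L"
    then obtain v where v: "v \<noteq> 0" "C = conj_class (D2k_d n \<inter> line_stab v)"
      by blast
    obtain w z where wz: "v = cyl w z"
      by (rule cyl_exhaust)
    have unit: "norm (w / cnj w) = 1" "norm (- (w / cnj w)) = 1" if "w \<noteq> 0"
      using that by (simp_all add: norm_divide)
    consider "w = 0" | "w \<noteq> 0" "z = 0" | "w \<noteq> 0" "z \<noteq> 0"
      by auto
    then show "C \<in> ?R"
    proof cases
      case 1
      then show ?thesis using v wz by (simp add: D2k_d_Int_line_stab[OF n])
    next
      case 2
      then have "C = conj_class (horizontal_stab n (w / cnj w))"
        using v wz by (simp add: D2k_d_Int_line_stab[OF n] horizontal_stab_def)
      then show ?thesis using unit 2 by blast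
    next
      case 3
      then have "C = conj_class (insert (mat 1) (signed_halfturn n (- (w / cnj w))))"
        using v wz by (simp add: D2k_d_Int_line_stab[OF n])
      then show ?thesis using unit 3 by blast
    qed
  qed
  show "?R \<subseteq> ?L"
  proof -
    have "conj_class (D2k_d n) = conj_class (D2k_d n \<inter> line_stab (cyl 0 1))"
      by (simp add: D2k_d_Int_line_stab[OF n])
    moreover have "\<exists>v. v \<noteq> 0 \<and> conj_class (insert (mat 1) (signed_halfturn n c)) =
        conj_class (D2k_d n \<inter> line_stab v)"
      and "\<exists>v. v \<noteq> 0 \<and> conj_class (horizontal_stab n c) = conj_class (D2k_d n \<inter> line_stab v)"
      if c: "norm c = 1" for c
    proof -
      have "norm (- c) = 1" using c by simp
      then obtain w where "w \<noteq> 0" "c = - (w / cnj w)"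
        by (metis unit_iff_divide_cnj minus_minus)
      then show "\<exists>v. v \<noteq> 0 \<and> conj_class (insert (mat 1) (signed_halfturn n c)) =
        conj_class (D2k_d n \<inter> line_stab v)"
        by (intro exI[of _ "cyl w 1"]) (simp add: D2k_d_Int_line_stab[OF n])
      obtain w where "w \<noteq> 0" "c = w / cnj w"
        using c unit_iff_divide_cnj by blast
      then show "\<exists>v. v \<noteq> 0 \<and> conj_class (horizontal_stab n c) = conj_class (D2k_d n \<inter> line_stab v)"
        by (intro exI[of _ "cyl w 0"]) (simp add: D2k_d_Int_line_stab[OF n] horizontal_stab_def)
    qed
    moreover have "cyl 0 1 \<noteq> 0" by simp
    ultimately show ?thesis by blast
  qed
qed

theorem lemma4p18:
  fixes n d2 :: nat
  assumes "n \<ge> 2" and "d2 = gcd 2 n"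
  shows "clips (conj_class (D2k_d n)) (conj_class (plus_Z2c SO2)) =
           {conj_class Triv, conj_class (Cyc 2), conj_class (Z2k_minus 1), conj_class (Z2k_minus n)}
       \<and> clips (conj_class (D2k_d n)) (conj_class (plus_Z2c O2)) =
           {conj_class Triv, conj_class (Cyc 2), conj_class (Z2k_minus 1), conj_class (Dih d2),
            conj_class D2_z, conj_class (D2k_d n)}"
proof
  have n: "n \<ge> 1" using assms(1) by simp
  show "clips (conj_class (D2k_d n)) (conj_class (plus_Z2c SO2)) =
      {conj_class Triv, conj_class (Cyc 2), conj_class (Z2k_minus 1), conj_class (Z2k_minus n)}"
    unfolding plus_Z2c_SO2 clips_axial axial_classes[OF assms(1)] classes_one_halfturn[OF n]
    by auto
  \<comment> \<open>For odd \<open>n\<close> the convention for \<open>Dih 1\<close> makes this entry repeat \<open>Cyc 2\<close>, which an oblique axis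
    provides.\<close>
  have "Dih d2 = (if even n then Dih 2 else Cyc 2)"
  proof (cases "even n")
    case True
    then have "gcd 2 n = 2" by (metis gcd_nat.absorb1)
    with True assms(2) show ?thesis by simp
  next
    case False
    then have "gcd 2 n = 1" by (simp add: coprime_iff_gcd_eq_1[symmetric])
    with False assms(2) show ?thesis by (simp add: Dih_def)
  qed
  then show "clips (conj_class (D2k_d n)) (conj_class (plus_Z2c O2)) =
      {conj_class Triv, conj_class (Cyc 2), conj_class (Z2k_minus 1), conj_class (Dih d2),
       conj_class D2_z, conj_class (D2k_d n)}"
    unfolding plus_Z2c_O2 clips_line_stab line_stab_classes[OF assms(1)] classes_one_halfturn[OF n]
      classes_horizontal_stab[OF n]
    by auto
qed

end
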